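(* Let $(M,d)$ be a metric space and $\lambda\ge 1$. 1) If there is a good-$\lambda$-embedding from $M$ into $c_0$, then $M$ has property $\pi(\lambda)$. 2) If there is a $\lambda$-embedding from $M$ into $c_0$, then $M$ has property weak-$\pi(\lambda)$.
   Context: $c_0$ is the Banach space of real sequences converging to $0$ with the sup norm $\|\cdot\|$. For a map $g$ between metric spaces, $Lip(g)$ is its Lipschitz constant. A map $f:M\to c_0$ is a $\lambda$-embedding if $d(x,y)\le\|f(x)-f(y)\|\le\lambda d(x,y)$ for all $x,y\in M$. A map $f=(f_n):M\to c_0$ is a good-$\lambda$-embedding if $Lip(f_n)<\lambda$ for each $n$ and for all $x,y\in M$ there is $n$ with $d(x,y)\le|f_n(x)-f_n(y)|$. For a nonempty $E\subset M\times M$, let $\pi_1(E)=\{x\in M:\exists y\in M,\ (x,y)\in E\}$, $\pi_2(E)=\{y\in M:\exists x\in M,\ (x,y)\in E\}$, $\pi(E)=\pi_1(E)\times\pi_2(E)$, $\delta(E)=\inf\{d(x,y):(x,y)\in E\}$ and $diam(E)=\sup\{d(x,y):(x,y)\in E\}$. $(M,d)$ has property $\pi(\lambda)$ if for all balls $B_1,B_2$ of $M$ of radii $r_1,r_2$ and every nonempty $E\subset B_1\times B_2$ with $\delta(E)>\lambda(r_1+r_2)$, there is a finite partition $\{E_1,\dots,E_N\}$ of $E$ such that $diam(E_n)<\lambda\,\delta(\pi(E_n))$ for each $n$. $(M,d)$ has property weak-$\pi(\lambda)$ if for all such $B_1,B_2,r_1,r_2,E$ (nonempty $E\subset B_1\times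 B_2$ with $\delta(E)>\lambda(r_1+r_2)$) there are finitely many nonempty closed subsets $F_1,\dots,F_N$ of $M\times M$ covering $E$ such that $r_1+r_2<\delta(\pi(F_n))$ for each $n$. Here balls are closed balls of positive radius (using open balls gives equivalent properties). *)

theory Defs
  imports "HOL-Analysis.Analysis"
begin

(* Since nat is discrete, (nat, real) bcontfun is the space of all bounded real sequences
   with the sup norm; c0 is its closed subspace of null sequences, with the induced norm. *)
definition c0 :: "(nat, real) bcontfun set" where
  "c0 = {u. (\<lambda>n. apply_bcontfun u n) \<longlonglongrightarrow> 0}"

(* Extended-real valued, so that Lip g = \<infinity> when g is not Lipschitz. *)
definition Lip :: "('a::metric_space \<Rightarrow> 'b::metric_space) \<Rightarrow> ereal" where
  "Lip g = (INF L \<in> {L. L-lipschitz_on UNIV g}. ereal L)"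

definition c0_embedding :: "real \<Rightarrow> ('a::metric_space \<Rightarrow> (nat, real) bcontfun) \<Rightarrow> bool" where
  "c0_embedding l f \<longleftrightarrow>
     range f \<subseteq> c0 \<and>
     (\<forall>x y. dist x y \<le> norm (f x - f y) \<and> norm (f x - f y) \<le> l * dist x y)"

definition good_c0_embedding :: "real \<Rightarrow> ('a::metric_space \<Rightarrow> (nat, real) bcontfun) \<Rightarrow> bool" where
  "good_c0_embedding l f \<longleftrightarrow>
     range f \<subseteq> c0 \<and>
     (\<forall>n. Lip (\<lambda>x. apply_bcontfun (f x) n) < ereal l) \<and>
     (\<forall>x y. \<exists>n. dist x y \<le> \<bar>apply_bcontfun (f x) n - apply_bcontfun (f y) n\<bar>)"

(* The product of the two projections of E, written pi(E) in the mathematical text. *)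
definition rect :: "('a \<times> 'a) set \<Rightarrow> ('a \<times> 'a) set" where
  "rect E = Domain E \<times> Range E"

(* Infimum and supremum of the distance over a set of pairs, not the distance or diameter
   of subsets of the product space.  They are the intended real numbers when E is nonempty
   and, for pair_diam, distances on E are bounded; both hold wherever they are used below. *)
definition pair_gap :: "('a::metric_space \<times> 'a) set \<Rightarrow> real" where
  "pair_gap E = (INF (x, y) \<in> E. dist x y)"

definition pair_diam :: "('a::metric_space \<times> 'a) set \<Rightarrow> real" where
  "pair_diam E = (SUP (x, y) \<in> E. dist x y)"

(* The metric space is the whole type 'a. *)
definition property_pi :: "'a::metric_space itself \<Rightarrow> real \<Rightarrow> bool" where
  "property_pi (_ :: 'a itself) l \<longleftrightarrow>
     (\<forall>(a1::'a) a2 r1 r2 E.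
        r1 > 0 \<and> r2 > 0 \<and> E \<noteq> {} \<and> E \<subseteq> cball a1 r1 \<times> cball a2 r2 \<and>
        pair_gap E > l * (r1 + r2) \<longrightarrow>
        (\<exists>P. finite P \<and> partition_on E P \<and>
             (\<forall>A\<in>P. pair_diam A < l * pair_gap (rect A))))"

definition property_weak_pi :: "'a::metric_space itself \<Rightarrow> real \<Rightarrow> bool" where
  "property_weak_pi (_ :: 'a itself) l \<longleftrightarrow>
     (\<forall>(a1::'a) a2 r1 r2 E.
        r1 > 0 \<and> r2 > 0 \<and> E \<noteq> {} \<and> E \<subseteq> cball a1 r1 \<times> cball a2 r2 \<and>
        pair_gap E > l * (r1 + r2) \<longrightarrow>
        (\<exists>\<F>. finite \<F> \<and> (\<forall>F\<in>\<F>. F \<noteq> {} \<and> closed F) \<and> E \<subseteq> \<Union>\<F> \<and>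
             (\<forall>F\<in>\<F>. r1 + r2 < pair_gap (rect F))))"

end

theory Submission
  imports Defs
begin

text \<open>
  A coordinate separating a pair of \<open>E\<close> by more than \<open>l * (r1 + r2)\<close> must, being \<open>l\<close>-Lipschitz,
  separate the two centres by a fixed positive amount; as the images of the centres are null
  sequences, only finitely many coordinates are involved.  Each of them is bounded on the two balls,
  so cutting its range into short intervals splits \<open>E\<close> into finitely many cells.  On a cell the
  separating coordinate is almost constant on either projection, so a lower bound for its increment
  at one pair of \<open>E\<close> carries over to all pairs of the rectangle spanned by the cell.
\<close>

text \<open>Here \<open>m\<close> picks a separating coordinate for each pair. The interval length
  \<open>e\<close> may depend on the coordinate, because the Lipschitz constants of a good embedding
  lie below \<open>l\<close> with no uniform margin.\<close>

definition cell_label ::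
    "(nat \<Rightarrow> 'a \<Rightarrow> real) \<Rightarrow> (nat \<Rightarrow> real) \<Rightarrow> ('a \<times> 'a \<Rightarrow> nat) \<Rightarrow> 'a \<times> 'a \<Rightarrow> nat \<times> int \<times> int" where
  "cell_label g e m p =
     (m p, \<lfloor>g (m p) (fst p) / e (m p)\<rfloor>, \<lfloor>g (m p) (snd p) / e (m p)\<rfloor>)"

section \<open>Finiteness of the set of labels\<close>

lemma finite_floor_image:
  fixes h :: "'a \<Rightarrow> real"
  assumes "\<And>x. x \<in> A \<Longrightarrow> \<bar>h x - c\<bar> \<le> b"
  shows "finite ((\<lambda>x. \<lfloor>h x\<rfloor>) ` A)"
proof (rule finite_subset)
  show "(\<lambda>x. \<lfloor>h x\<rfloor>) ` A \<subseteq> {\<lfloor>c - b\<rfloor>..\<lfloor>c + b\<rfloor>}"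
    using assms by (force intro!: floor_mono simp: abs_le_iff)
qed simp

lemma lipschitz_real_le:
  fixes h :: "'a::metric_space \<Rightarrow> real"
  assumes "l-lipschitz_on UNIV h"
  shows "\<bar>h x - h y\<bar> \<le> l * dist x y"
  using lipschitz_onD[OF assms, of x y] by (simp add: dist_real_def)

lemma finite_floor_ball_image:
  fixes h :: "'a::metric_space \<Rightarrow> real"
  assumes "l-lipschitz_on UNIV h" "e > 0"
  shows "finite ((\<lambda>x. \<lfloor>h x / e\<rfloor>) ` cball a r)"
proof (rule finite_floor_image)
  fix x assume "x \<in> cball a r"
  moreover have "0 \<le> l" using assms(1) by (rule lipschitz_on_nonneg)
  ultimately have "l * dist x a \<le> l * r" by (simp add: dist_commute mult_left_mono)
  then have "\<bar>h x - h a\<bar> \<le> l * r"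
    using lipschitz_real_le[OF assms(1), of x a] by linarith
  then show "\<bar>h x / e - h a / e\<bar> \<le> l * r / e"
    using assms(2) by (simp add: divide_right_mono flip: diff_divide_distrib)
qed

lemma finite_separating_coordinates:
  fixes g :: "nat \<Rightarrow> 'a::metric_space \<Rightarrow> real"
  assumes lip: "\<And>n. l-lipschitz_on UNIV (g n)"
    and null: "\<And>x. (\<lambda>n. g n x) \<longlonglongrightarrow> 0"
    and eta: "eta > l * (r1 + r2)"
  shows "finite {n. \<exists>x\<in>cball a1 r1. \<exists>y\<in>cball a2 r2. eta \<le> \<bar>g n x - g n y\<bar>}"
proof -
  have "(\<lambda>n. g n a1 - g n a2) \<longlonglongrightarrow> 0 - 0"
    by (intro tendsto_diff null)
  then have "\<forall>\<^sub>F n in sequentially. \<bar>g n a1 - g n a2\<bar> < eta - l * (r1 + r2)"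
    using eta by (simp add: tendsto_iff dist_real_def)
  then have fin: "finite {n. \<not> \<bar>g n a1 - g n a2\<bar> < eta - l * (r1 + r2)}"
    by (simp add: eventually_cofinite flip: cofinite_eq_sequentially)
  show ?thesis
  proof (rule finite_subset[OF _ fin], clarsimp)
    fix n x y
    assume x: "dist a1 x \<le> r1" and y: "dist a2 y \<le> r2" and n: "eta \<le> \<bar>g n x - g n y\<bar>"
      and less: "\<bar>g n a1 - g n a2\<bar> < eta - l * (r1 + r2)"
    have "0 \<le> l" using lip by (rule lipschitz_on_nonneg)
    then have "l * dist a1 x \<le> l * r1" "l * dist a2 y \<le> l * r2"
      using x y by (simp_all add: mult_left_mono)
    then have "\<bar>g n a1 - g n x\<bar> \<le> l * r1" "\<bar>g n a2 - g n y\<bar> \<le> l * r2"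
      using lipschitz_real_le[OF lip, of n a1 x] lipschitz_real_le[OF lip, of n a2 y] by linarith+
    then show False
      using n less by (simp add: distrib_left)
  qed
qed

text \<open>The level \<open>eta\<close> is kept general: it is \<open>pair_gap E\<close> for good
  embeddings and a strictly smaller number for the weak property. A label is determined by one of
  finitely many coordinates and two floors, each of which takes finitely many values on its
  ball.\<close>

lemma finite_cell_labels:
  fixes g :: "nat \<Rightarrow> 'a::metric_space \<Rightarrow> real"
  assumes lip: "\<And>n. l-lipschitz_on UNIV (g n)"
    and null: "\<And>x. (\<lambda>n. g n x) \<longlonglongrightarrow> 0"
    and eta: "eta > l * (r1 + r2)"
    and E: "E \<subseteq> cball a1 r1 \<times> cball a2 r2"
    and sep: "\<And>x y. (x, y) \<in> E \<Longrightarrow> eta \<le> \<bar>g (m (x, y)) x - g (m (x, y)) y\<bar>"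
    and e: "\<And>n. e n > 0"
  shows "finite (cell_label g e m ` E)"
proof (rule finite_subset)
  define G where "G = {n. \<exists>x\<in>cball a1 r1. \<exists>y\<in>cball a2 r2. eta \<le> \<bar>g n x - g n y\<bar>}"
  let ?I = "\<lambda>n a r. (\<lambda>x. \<lfloor>g n x / e n\<rfloor>) ` cball a r"
  show "cell_label g e m ` E \<subseteq> (SIGMA n:G. ?I n a1 r1 \<times> ?I n a2 r2)"
  proof (intro image_subsetI)
    fix p assume "p \<in> E"
    then obtain x y where p: "p = (x, y)" "x \<in> cball a1 r1" "y \<in> cball a2 r2"
      using E by blast
    with \<open>p \<in> E\<close> sep have "m p \<in> G" unfolding G_def by blast
    with p show "cell_label g e m p \<in> (SIGMA n:G. ?I n a1 r1 \<times> ?I n a2 r2)"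
      unfolding cell_label_def by auto
  qed
  have "finite G"
    unfolding G_def using lip null eta by (rule finite_separating_coordinates)
  then show "finite (SIGMA n:G. ?I n a1 r1 \<times> ?I n a2 r2)"
    using finite_floor_ball_image[OF lip e] by (intro finite_SigmaI finite_cartesian_product)
qed

section \<open>Level sets, rounding, and bounds on gaps and diameters\<close>

lemma partition_on_level_sets: "partition_on E ((\<lambda>c. {p \<in> E. f p = c}) ` f ` E)"
  by (auto simp: partition_on_def disjoint_def)

lemma floor_divide_bounds:
  fixes e :: real
  assumes "e > 0"
  shows "of_int \<lfloor>t / e\<rfloor> * e \<le> t" "t \<le> (of_int \<lfloor>t / e\<rfloor> + 1) * e"
proof -
  show "of_int \<lfloor>t / e\<rfloor> * e \<le> t"
    using assms by (simp flip: pos_le_divide_eq)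
  have "t / e \<le> of_int \<lfloor>t / e\<rfloor> + 1" by linarith
  then show "t \<le> (of_int \<lfloor>t / e\<rfloor> + 1) * e"
    using assms by (simp only: pos_divide_le_eq)
qed

lemma floor_divide_eq_imp_near:
  fixes e :: real
  assumes "e > 0" "\<lfloor>s / e\<rfloor> = \<lfloor>t / e\<rfloor>"
  shows "\<bar>s - t\<bar> \<le> e"
  using floor_divide_bounds[OF assms(1), of s] floor_divide_bounds[OF assms(1), of t] assms(2)
  by (simp add: distrib_right)

lemma pair_gap_le:
  assumes "(x, y) \<in> E"
  shows "pair_gap E \<le> dist x y"
proof -
  have "bdd_below ((\<lambda>(x, y). dist x y) ` E)"
    by (rule bdd_belowI[of _ 0]) auto
  then show ?thesis
    unfolding pair_gap_def using assms by (metis (no_types, lifting) cINF_lower case_prod_conv)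
qed

lemma pair_gap_greatest:
  assumes "E \<noteq> {}" "\<And>x y. (x, y) \<in> E \<Longrightarrow> c \<le> dist x y"
  shows "c \<le> pair_gap E"
  unfolding pair_gap_def using assms by (intro cINF_greatest) auto

lemma pair_diam_least:
  assumes "E \<noteq> {}" "\<And>x y. (x, y) \<in> E \<Longrightarrow> dist x y \<le> c"
  shows "pair_diam E \<le> c"
  unfolding pair_diam_def using assms by (intro cSUP_least) auto

lemma rect_nonempty: "E \<noteq> {} \<Longrightarrow> rect E \<noteq> {}"
  by (auto simp: rect_def)

section \<open>Good embeddings and property pi\<close>

lemma Lip_less_imp_lipschitz:
  assumes "Lip g < ereal l" "0 < l"
  obtains L where "0 < L" "L < l" "L-lipschitz_on UNIV g"
proof -
  obtain L where L: "L-lipschitz_on UNIV g" "L < l"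
    using assms(1) by (auto simp: Lip_def INF_less_iff)
  show thesis
  proof (rule that)
    \<comment> \<open>The constant \<open>L\<close> may be 0, for instance when \<open>g\<close> is
      constant; raising it keeps later divisions by it legitimate.\<close>
    show "0 < max L (l / 2)" "max L (l / 2) < l" using L assms(2) by auto
    show "(max L (l / 2))-lipschitz_on UNIV g" using L(1) by (rule lipschitz_on_mono) auto
  qed
qed

text \<open>On a cell with coordinate \<open>n\<close>, all distances are at most
  \<open>L n * q + 2 * e n\<close>, where \<open>q\<close> is the gap of its rectangle. The margin
  \<open>l - L n\<close> absorbs the rounding error once \<open>q\<close> is bounded below.\<close>

lemma good_c0_embedding_imp_property_pi:
  fixes f :: "'a::metric_space \<Rightarrow> (nat, real) bcontfun"
  assumes f: "good_c0_embedding l f" and l: "l > 0"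
  shows "property_pi TYPE('a) l"
  unfolding property_pi_def
proof (intro allI impI, elim conjE)
  fix a1 a2 :: 'a and r1 r2 E
  assume r: "0 < r1" "0 < r2" and E: "E \<subseteq> cball a1 r1 \<times> cball a2 r2"
    and gap: "l * (r1 + r2) < pair_gap E"
  define d where "d = pair_gap E"
  have "0 < d" unfolding d_def using gap r l by (smt (verit) mult_pos_pos)
  define g where "g n x = apply_bcontfun (f x) n" for n x
  have "\<exists>L>0. L < l \<and> L-lipschitz_on UNIV (g n)" for n
    using f l Lip_less_imp_lipschitz[of "g n" l] unfolding good_c0_embedding_def g_def by metis
  then obtain L where L: "\<And>n. 0 < L n" "\<And>n. L n < l" "\<And>n. (L n)-lipschitz_on UNIV (g n)"
    by metis
  have lip: "l-lipschitz_on UNIV (g n)" for n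
    using L(3)[of n] by (rule lipschitz_on_mono) (use L(2)[of n] in auto)
  have null: "(\<lambda>n. g n x) \<longlonglongrightarrow> 0" for x
    using f by (auto simp: good_c0_embedding_def c0_def g_def)
  have "\<exists>n. dist (fst p) (snd p) \<le> \<bar>g n (fst p) - g n (snd p)\<bar>" for p
    using f by (auto simp: good_c0_embedding_def g_def)
  then obtain m where m: "\<And>p. dist (fst p) (snd p) \<le> \<bar>g (m p) (fst p) - g (m p) (snd p)\<bar>"
    by metis
  \<comment> \<open>The total error \<open>2 * e n\<close> is the margin \<open>l - L n\<close>
    times \<open>d / (2 * l)\<close>, the lower bound shown below for \<open>q\<close>.\<close>
  define e where "e n = (l - L n) * d / (4 * l)" for n
  have e: "e n > 0" for n
    unfolding e_def using L(2)[of n] l \<open>0 < d\<close> by simp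
  define lab where "lab = cell_label g e m"
  define P where "P = (\<lambda>c. {p \<in> E. lab p = c}) ` lab ` E"
  have "finite (lab ` E)"
    unfolding lab_def using lip null gap E
  proof (rule finite_cell_labels)
    show "pair_gap E \<le> \<bar>g (m (x, y)) x - g (m (x, y)) y\<bar>" if "(x, y) \<in> E" for x y
      using m[of "(x, y)"] pair_gap_le[OF that] by simp
  qed (rule e)
  moreover have "pair_diam A < l * pair_gap (rect A)" if "A \<in> P" for A
  proof -
    obtain c where c: "A = {p \<in> E. lab p = c}" and "A \<noteq> {}"
      using \<open>A \<in> P\<close> unfolding P_def by blast
    obtain n i j where "c = (n, i, j)" by (rule prod_cases3)
    with c have A: "A = {p \<in> E. lab p = (n, i, j)}" by simp
    have near: "dist x y \<le> L n * dist u v + 2 * e n"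
      if xy: "(x, y) \<in> A" and uv: "(u, v) \<in> rect A" for x y u v
    proof -
      \<comment> \<open>The ends \<open>u\<close> and \<open>v\<close> may come from different pairs
        of \<open>A\<close>; the common label still places their values under coordinate
        \<open>n\<close> in the intervals \<open>i\<close> and \<open>j\<close>.\<close>
      obtain v' u' where "(u, v') \<in> A" "(u', v) \<in> A"
        using uv by (auto simp: rect_def)
      then have u: "\<lfloor>g n u / e n\<rfloor> = i" and v: "\<lfloor>g n v / e n\<rfloor> = j"
        by (auto simp: A lab_def cell_label_def)
      have x: "\<lfloor>g n x / e n\<rfloor> = i" and y: "\<lfloor>g n y / e n\<rfloor> = j" and "m (x, y) = n"
        using xy by (auto simp: A lab_def cell_label_def)
      then have "dist x y \<le> \<bar>g n x - g n y\<bar>"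
        using m[of "(x, y)"] by simp
      moreover have "\<bar>g n x - g n u\<bar> \<le> e n" "\<bar>g n y - g n v\<bar> \<le> e n"
        using x y u v by (simp_all add: floor_divide_eq_imp_near[OF e])
      ultimately show ?thesis
        using lipschitz_real_le[OF L(3), of n u v] by linarith
    qed
    define q where "q = pair_gap (rect A)"
    have le: "dist x y \<le> L n * q + 2 * e n" if xy: "(x, y) \<in> A" for x y
    proof -
      \<comment> \<open>In this form the estimate is a lower bound for every
        \<open>dist u v\<close>, so it passes to the infimum.\<close>
      have "(dist x y - 2 * e n) / L n \<le> q"
        unfolding q_def
      proof (rule pair_gap_greatest)
        show "rect A \<noteq> {}" using \<open>A \<noteq> {}\<close> by (rule rect_nonempty)
        show "(dist x y - 2 * e n) / L n \<le> dist u v" if "(u, v) \<in> rect A" for u v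
          using near[OF xy that] L(1)[of n] by (simp add: pos_divide_le_eq mult.commute)
      qed
      then show ?thesis
        using L(1)[of n] by (simp add: pos_divide_le_eq mult.commute)
    qed
    have "0 \<le> q"
      unfolding q_def using rect_nonempty[OF \<open>A \<noteq> {}\<close>] by (rule pair_gap_greatest) simp
    \<comment> \<open>A single pair gives the lower bound on \<open>q\<close>: its distance is at
      least \<open>d\<close>, and the error is below \<open>d / 2\<close>.\<close>
    obtain x y where "(x, y) \<in> A" using \<open>A \<noteq> {}\<close> by auto
    then have "d \<le> dist x y" unfolding d_def A by (auto intro: pair_gap_le)
    with le \<open>(x, y) \<in> A\<close> have "d \<le> L n * q + 2 * e n" by fastforce
    moreover have "L n * q \<le> l * q"
      using L(2)[of n] \<open>0 \<le> q\<close> by (simp add: mult_right_mono)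
    moreover have "2 * e n < d / 2"
      unfolding e_def using L(1)[of n] l \<open>0 < d\<close> by (simp add: field_simps)
    ultimately have "d / (2 * l) < q"
      using l by (simp add: field_simps)
    then have "(l - L n) * (d / (2 * l)) < (l - L n) * q"
      using L(2)[of n] by (intro mult_strict_left_mono) auto
    moreover have "(l - L n) * (d / (2 * l)) = 2 * e n"
      by (simp add: e_def)
    ultimately have "L n * q + 2 * e n < l * q"
      by (simp add: algebra_simps)
    \<comment> \<open>The strict inequality just obtained does not involve the pair, so it survives
      the supremum.\<close>
    moreover have "pair_diam A \<le> L n * q + 2 * e n"
      using \<open>A \<noteq> {}\<close> le by (rule pair_diam_least)
    ultimately show ?thesis unfolding q_def by linarith
  qed
  ultimately show "\<exists>P. finite P \<and> partition_on E P \<and> (\<forall>A\<in>P. pair_diam A < l * pair_gap (rect A))"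
    using partition_on_level_sets[of E lab] unfolding P_def by blast
qed

section \<open>Embeddings and property weak-pi\<close>

lemma c0_embedding_imp_property_weak_pi:
  fixes f :: "'a::metric_space \<Rightarrow> (nat, real) bcontfun"
  assumes f: "c0_embedding l f" and l: "l > 0"
  shows "property_weak_pi TYPE('a) l"
  unfolding property_weak_pi_def
proof (intro allI impI, elim conjE)
  fix a1 a2 :: 'a and r1 r2 E
  assume E: "E \<subseteq> cball a1 r1 \<times> cball a2 r2" and gap: "l * (r1 + r2) < pair_gap E"
  \<comment> \<open>Staying strictly below \<open>pair_gap E\<close> lets some coordinate reach
    \<open>eta\<close> without an appeal to the sup norm being attained.\<close>
  obtain eta where eta: "l * (r1 + r2) < eta" "eta < pair_gap E"
    using gap dense by blast
  define g where "g n x = apply_bcontfun (f x) n" for n x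
  have lip: "l-lipschitz_on UNIV (g n)" for n
  proof (rule lipschitz_onI)
    fix x y
    have "dist (g n x) (g n y) \<le> norm (f x - f y)"
      using norm_bounded[of "f x - f y" n] by (simp add: g_def dist_real_def)
    then show "dist (g n x) (g n y) \<le> l * dist x y"
      using f unfolding c0_embedding_def by (meson order_trans)
  qed (use l in simp)
  have null: "(\<lambda>n. g n x) \<longlonglongrightarrow> 0" for x
    using f by (auto simp: c0_embedding_def c0_def g_def)
  have "\<exists>n. eta \<le> \<bar>g n (fst p) - g n (snd p)\<bar>" if "p \<in> E" for p
  proof (rule ccontr)
    assume "\<nexists>n. eta \<le> \<bar>g n (fst p) - g n (snd p)\<bar>"
    then have "norm (f (fst p) - f (snd p)) \<le> eta"
      by (intro norm_bound) (simp add: g_def not_le less_imp_le)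
    moreover have "dist (fst p) (snd p) \<le> norm (f (fst p) - f (snd p))"
      using f by (simp add: c0_embedding_def)
    moreover have "pair_gap E \<le> dist (fst p) (snd p)"
      using that by (simp add: pair_gap_le)
    ultimately show False using eta(2) by linarith
  qed
  then obtain m where m: "\<And>p. p \<in> E \<Longrightarrow> eta \<le> \<bar>g (m p) (fst p) - g (m p) (snd p)\<bar>"
    by metis
  \<comment> \<open>With this length \<open>eta - 2 * e\<close> is the midpoint of
    \<open>eta\<close> and \<open>l * (r1 + r2)\<close>, hence still above the latter.\<close>
  define e where "e = (eta - l * (r1 + r2)) / 4"
  have e: "e > 0" unfolding e_def using eta by simp
  define lab where "lab = cell_label g (\<lambda>_. e) m"
  \<comment> \<open>Closed intervals replace the half-open ones of the floor function, as the
    covering sets must be closed; overlaps are harmless in a cover.\<close>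
  define strip where "strip n i = {x. of_int i * e \<le> g n x \<and> g n x \<le> (of_int i + 1) * e}"
    for n and i :: int
  define cell where "cell = (\<lambda>(n, i, j). strip n i \<times> strip n j)"
  have "finite (lab ` E)"
    unfolding lab_def using lip null eta(1) E
  proof (rule finite_cell_labels)
    show "eta \<le> \<bar>g (m (x, y)) x - g (m (x, y)) y\<bar>" if "(x, y) \<in> E" for x y
      using m[OF that] by simp
  qed (rule e)
  moreover have in_cell: "p \<in> cell (lab p)" for p
    using floor_divide_bounds[OF e]
    by (cases p) (simp add: cell_def lab_def cell_label_def strip_def)
  moreover have "closed (cell c)" for c
  proof -
    have "closed (strip n i)" for n i
      unfolding strip_def
      using lipschitz_on_continuous_on[OF lip]
      by (intro closed_Collect_conj closed_Collect_le) auto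
    then show ?thesis by (cases c) (simp add: cell_def closed_Times)
  qed
  \<comment> \<open>The cell may extend beyond \<open>E\<close> and the balls. Separation by
    \<open>eta\<close> is used only at \<open>p\<close>; the width of the strips carries it over to
    the whole cell.\<close>
  moreover have "r1 + r2 < pair_gap (rect (cell (lab p)))" if "p \<in> E" for p
  proof -
    obtain n i j where c: "lab p = (n, i, j)" using prod_cases3 by blast
    have n: "m p = n" using c by (simp add: lab_def cell_label_def)
    have p: "fst p \<in> strip n i" "snd p \<in> strip n j"
      using in_cell[of p] c by (auto simp: cell_def)
    have "(eta - 2 * e) / l \<le> pair_gap (rect (cell (lab p)))"
    proof (rule pair_gap_greatest)
      show "rect (cell (lab p)) \<noteq> {}" using in_cell[of p] by (intro rect_nonempty) auto
      fix u v assume "(u, v) \<in> rect (cell (lab p))"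
      then have "u \<in> strip n i" "v \<in> strip n j" by (auto simp: rect_def cell_def c)
      then have "\<bar>g n (fst p) - g n u\<bar> \<le> e" "\<bar>g n (snd p) - g n v\<bar> \<le> e"
        using p by (auto simp: strip_def distrib_right)
      then have "eta - 2 * e \<le> \<bar>g n u - g n v\<bar>"
        using m[OF \<open>p \<in> E\<close>] unfolding n by linarith
      then have "eta - 2 * e \<le> l * dist u v"
        using lipschitz_real_le[OF lip, of n u v] by linarith
      then show "(eta - 2 * e) / l \<le> dist u v"
        using l by (simp add: pos_divide_le_eq mult.commute)
    qed
    moreover have "r1 + r2 < (eta - 2 * e) / l"
      using l eta(1) by (simp add: e_def pos_less_divide_eq field_simps)
    ultimately show ?thesis by linarith
  qed
  ultimately show "\<exists>\<F>. finite \<F> \<and> (\<forall>F\<in>\<F>. F \<noteq> {} \<and> closed F) \<and> E \<subseteq> \<Union>\<F> \<and>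
      (\<forall>F\<in>\<F>. r1 + r2 < pair_gap (rect F))"
    by (intro exI[of _ "cell ` lab ` E"]) blast
qed

theorem proposition2p3:
  fixes l :: real
  assumes "l \<ge> 1"
  shows "((\<exists>f :: 'a::metric_space \<Rightarrow> (nat, real) bcontfun. good_c0_embedding l f)
            \<longrightarrow> property_pi TYPE('a) l) \<and>
         ((\<exists>f :: 'a \<Rightarrow> (nat, real) bcontfun. c0_embedding l f)
            \<longrightarrow> property_weak_pi TYPE('a) l)"
proof -
  have "l > 0" using assms by simp
  then show ?thesis
    by (blast intro: good_c0_embedding_imp_property_pi c0_embedding_imp_property_weak_pi)
qed

end
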